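(* Let $d\ge3$, $\varepsilon\in(0,1)$, $K\ge1$ and let $W^{(1)},\dots,W^{(K)}$ be Brownian motions in $\mathbb R^d$. Let $$\mathcal V_K=\mathbb R^d\setminus\bigcup_{k=1}^K\bigcup_{t\ge0}B\big(W^{(k)}_t,1\big).$$ If $\mathcal V_K\cap B(0,\varepsilon)$ contains at least $2$ connected components, then (1) for every $e\in\mathbb R^d$ with $\|e\|=1$, the set $\{x\in B(0,1+\varepsilon):\langle x,e\rangle\ge-\varepsilon\}$ is hit by at least one of the Brownian motions $W^{(1)},\dots,W^{(K)}$; (2) $B(0,1-\varepsilon)$ is not visited by any of the Brownian motions $W^{(1)},\dots,W^{(K)}$.
   Context: $B(x,r)$ denotes the closed Euclidean ball in $\mathbb R^d$ of radius $r$ centered at $x$. A Brownian motion hits (visits) a set $A$ if $W_t\in A$ for some $t\ge0$. The statement is deterministic: it holds for every realization of the paths. *)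

theory Defs
  imports "HOL-Probability.Probability"
begin

(* Standard d-dimensional Brownian motion indexed by t >= 0. The law of the
   starting point W 0 is left arbitrary. Taking t 0 = 0, the family with W 0 at
   index 0 expresses that the increments are independent of each other and of the
   starting point. All paths (not just almost all) are continuous. Values of W
   at negative times are irrelevant. *)
definition brownian_motion :: "'w measure \<Rightarrow> (real \<Rightarrow> 'w \<Rightarrow> real ^ 'd) \<Rightarrow> bool" where
  "brownian_motion M W \<longleftrightarrow>
     prob_space M \<and>
     (\<forall>t\<ge>0. W t \<in> borel_measurable M) \<and>
     (\<forall>(t :: nat \<Rightarrow> real) n. t 0 = 0 \<and> mono t \<longrightarrow>
        prob_space.indep_vars M (\<lambda>_. borel)
          (\<lambda>i \<omega>. if i = 0 then W 0 \<omega> else W (t i) \<omega> - W (t (i - 1)) \<omega>) {..n}) \<and>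
     (\<forall>s t. 0 \<le> s \<and> s < t \<longrightarrow>
        distributed M lborel (\<lambda>\<omega>. W t \<omega> - W s \<omega>)
          (\<lambda>x. ennreal (\<Prod>i\<in>UNIV. normal_density 0 (sqrt (t - s)) (x $ i)))) \<and>
     (\<forall>\<omega>\<in>space M. continuous_on {0..} (\<lambda>t. W t \<omega>))"

definition hits :: "(real \<Rightarrow> 'a) \<Rightarrow> 'a set \<Rightarrow> bool" where
  "hits w A \<longleftrightarrow> (\<exists>t\<ge>0. w t \<in> A)"

definition vacant_set :: "nat \<Rightarrow> (nat \<Rightarrow> real \<Rightarrow> real ^ 'd) \<Rightarrow> (real ^ 'd) set" where
  "vacant_set K w = UNIV - (\<Union>k\<in>{1..K}. \<Union>t\<in>{0..}. cball (w k t) 1)"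

end

theory Submission imports Defs begin

text \<open>
  Part (2) is the triangle inequality: the unit ball around a visited point of
  \<open>cball 0 (1 - \<epsilon>)\<close> covers all of \<open>cball 0 \<epsilon>\<close>, and the empty set has no components.

  For part (1), suppose that the paths miss the set \<open>{x \<in> cball 0 (1 + \<epsilon>). x \<bullet> e \<ge> - \<epsilon>}\<close>. A ball
  of radius 1 that meets \<open>cball 0 \<epsilon>\<close> then has its centre \<open>y\<close> below \<open>cball 0 \<epsilon>\<close>, with \<open>e\<close>
  pointing upwards: \<open>y \<bullet> e < - \<epsilon>\<close>. So a vacant point stays vacant when it moves upwards inside
  \<open>cball 0 \<epsilon>\<close>, and can be moved to the upper half of the sphere of radius \<open>\<epsilon>\<close>. Two vacant points of
  that hemisphere are joined by the arc that lies vertically above their chord. This arc is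
  vacant: on the sphere, \<open>(dist z y)\<^sup>2\<close> is the affine function
  \<open>\<epsilon>\<^sup>2 + (norm y)\<^sup>2 - 2 * (z \<bullet> y)\<close> of \<open>z\<close>; its values on the chord lie between those at the
  endpoints, and it increases in the direction \<open>e\<close> because \<open>y \<bullet> e < 0\<close>. Hence the vacant part of
  \<open>cball 0 \<epsilon>\<close> is path connected (lemma \<open>path_connected_outside_balls_below\<close>). The shorter
  choice of joining both points to the pole \<open>\<epsilon> *\<^sub>R e\<close> would fail, since the pole may be covered.
\<close>

text \<open>The height is the larger root \<open>s\<close> of the quadratic equation \<open>norm (x + s *\<^sub>R e) = \<rho>\<close>.\<close>

definition height_below_sphere :: "real \<Rightarrow> 'a::real_inner \<Rightarrow> 'a \<Rightarrow> real" where
  "height_below_sphere \<rho> e x = sqrt ((x \<bullet> e)\<^sup>2 + \<rho>\<^sup>2 - (norm x)\<^sup>2) - x \<bullet> e"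

definition lift_to_sphere :: "real \<Rightarrow> 'a::real_inner \<Rightarrow> 'a \<Rightarrow> 'a" where
  "lift_to_sphere \<rho> e x = x + height_below_sphere \<rho> e x *\<^sub>R e"

lemma height_below_sphere_nonneg:
  assumes "norm x \<le> \<rho>"
  shows "0 \<le> height_below_sphere \<rho> e x"
proof -
  have "(norm x)\<^sup>2 \<le> \<rho>\<^sup>2"
    using assms by (simp add: power_mono)
  then have "(x \<bullet> e)\<^sup>2 \<le> (x \<bullet> e)\<^sup>2 + \<rho>\<^sup>2 - (norm x)\<^sup>2"
    by simp
  then have "x \<bullet> e \<le> sqrt ((x \<bullet> e)\<^sup>2 + \<rho>\<^sup>2 - (norm x)\<^sup>2)"
    by (rule real_le_rsqrt)
  then show ?thesis
    by (simp add: height_below_sphere_def)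
qed

lemma norm_lift_to_sphere:
  assumes "norm e = 1" and "norm x \<le> \<rho>"
  shows "norm (lift_to_sphere \<rho> e x) = \<rho>"
proof -
  define s where "s = height_below_sphere \<rho> e x"
  have \<rho>: "0 \<le> \<rho>"
    using assms(2) norm_ge_zero order_trans by blast
  have "(norm x)\<^sup>2 \<le> \<rho>\<^sup>2"
    using assms by (simp add: power_mono)
  then have root: "(s + x \<bullet> e)\<^sup>2 = (x \<bullet> e)\<^sup>2 + \<rho>\<^sup>2 - (norm x)\<^sup>2"
    unfolding s_def height_below_sphere_def
    by (simp add: add_increasing add_diff_eq[symmetric] del: add_diff_eq)
  have "e \<bullet> e = 1"
    using assms(1) by (simp add: norm_eq_1)
  then have "(norm (x + s *\<^sub>R e))\<^sup>2 = (norm x)\<^sup>2 + ((s + x \<bullet> e)\<^sup>2 - (x \<bullet> e)\<^sup>2)"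
    unfolding power2_norm_eq_inner
    by (simp add: inner_simps inner_commute power2_eq_square algebra_simps)
  then have "(norm (x + s *\<^sub>R e))\<^sup>2 = \<rho>\<^sup>2"
    using root by simp
  then show ?thesis
    using \<rho> by (simp add: s_def lift_to_sphere_def)
qed

lemma inner_lift_to_sphere_nonneg:
  assumes "norm e = 1" and "norm x \<le> \<rho>"
  shows "0 \<le> lift_to_sphere \<rho> e x \<bullet> e"
proof -
  have "(norm x)\<^sup>2 \<le> \<rho>\<^sup>2"
    using assms by (simp add: power_mono)
  then have "0 \<le> sqrt ((x \<bullet> e)\<^sup>2 + \<rho>\<^sup>2 - (norm x)\<^sup>2)"
    by (simp add: add_increasing add_diff_eq[symmetric] del: add_diff_eq)
  moreover have "e \<bullet> e = 1"
    using assms(1) by (simp add: norm_eq_1)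
  ultimately show ?thesis
    by (simp add: lift_to_sphere_def height_below_sphere_def inner_simps)
qed

lemma lift_to_sphere_fixes_upper_hemisphere:
  assumes "norm z = \<rho>" and "0 \<le> z \<bullet> e"
  shows "lift_to_sphere \<rho> e z = z"
  using assms by (simp add: lift_to_sphere_def height_below_sphere_def)

lemma continuous_on_lift_to_sphere: "continuous_on A (lift_to_sphere \<rho> e)"
  unfolding lift_to_sphere_def height_below_sphere_def by (intro continuous_intros)

lemma dist_mono_moving_away:
  fixes x y e :: "'a::real_inner"
  assumes "0 \<le> t" and "y \<bullet> e \<le> x \<bullet> e"
  shows "dist x y \<le> dist (x + t *\<^sub>R e) y"
proof -
  have "0 \<le> 2 * t * ((x - y) \<bullet> e) + t\<^sup>2 * (e \<bullet> e)"
    using assms by (simp add: inner_diff_left)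
  also have "\<dots> = (norm (x + t *\<^sub>R e - y))\<^sup>2 - (norm (x - y))\<^sup>2"
    unfolding power2_norm_eq_inner
    by (simp add: inner_simps inner_commute power2_eq_square algebra_simps)
  finally have "(norm (x - y))\<^sup>2 \<le> (norm (x + t *\<^sub>R e - y))\<^sup>2"
    by simp
  then show ?thesis
    by (simp add: dist_norm)
qed

text \<open>On the sphere of radius \<open>\<rho>\<close>, the complement of \<open>cball y r\<close> is cut out by the half space
  \<open>H\<close> of the proof. A half space is convex, so \<open>H\<close> contains the chord, and lifting does not
  leave \<open>H\<close> because \<open>y \<bullet> e \<le> 0\<close>. The lifted point is on the sphere again.\<close>

lemma dist_lift_of_chord:
  fixes y e z z' p :: "'a::real_inner"
  assumes e: "norm e = 1" and y: "y \<bullet> e \<le> 0" and r: "0 \<le> r"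
    and z: "norm z = \<rho>" "r < dist z y" and z': "norm z' = \<rho>" "r < dist z' y"
    and p: "p \<in> closed_segment z z'"
  shows "r < dist (lift_to_sphere \<rho> e p) y"
proof -
  define H where "H = {v. y \<bullet> v < (\<rho>\<^sup>2 + (norm y)\<^sup>2 - r\<^sup>2) / 2}"
  have sphere: "r < dist v y \<longleftrightarrow> v \<in> H" if "norm v = \<rho>" for v
  proof -
    have "(dist v y)\<^sup>2 = \<rho>\<^sup>2 + (norm y)\<^sup>2 - 2 * (y \<bullet> v)"
      unfolding dist_norm that[symmetric] power2_norm_eq_inner
      by (simp add: inner_simps inner_commute)
    moreover have "r < dist v y \<longleftrightarrow> r\<^sup>2 < (dist v y)\<^sup>2"
      using r by (meson linorder_not_le power2_le_imp_le power_mono zero_le_dist)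
    ultimately show ?thesis
      by (auto simp: H_def field_simps)
  qed
  have "convex H"
    unfolding H_def by (rule convex_halfspace_lt)
  then have pH: "p \<in> H"
    using p z z' sphere closed_segment_subset[of z H z'] by blast
  have "p \<in> cball 0 \<rho>"
    using p z z' closed_segment_subset[OF _ _ convex_cball, of z 0 \<rho> z'] by auto
  then have p_le: "norm p \<le> \<rho>"
    by simp
  have "height_below_sphere \<rho> e p * (y \<bullet> e) \<le> 0"
    using y height_below_sphere_nonneg[OF p_le] by (rule mult_nonneg_nonpos[rotated])
  then have "lift_to_sphere \<rho> e p \<in> H"
    using pH by (simp add: H_def lift_to_sphere_def inner_simps)
  then show ?thesis
    using sphere norm_lift_to_sphere[OF e p_le] by blast
qed

text \<open>A centre \<open>y\<close> with \<open>norm y > r + \<rho>\<close> may lie anywhere, since its ball misses \<open>cball 0 \<rho>\<close>.\<close>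

lemma path_connected_outside_balls_below:
  fixes e :: "'a::real_inner"
  assumes e: "norm e = 1" and r: "0 \<le> r"
    and below: "\<And>y. y \<in> Y \<Longrightarrow> r + \<rho> < norm y \<or> y \<bullet> e < - \<rho>"
  shows "path_connected {x \<in> cball 0 \<rho>. \<forall>y\<in>Y. r < dist x y}" (is "path_connected ?S")
proof -
  let ?L = "lift_to_sphere \<rho> e"
  have far: "r < dist x y" if "r + \<rho> < norm y" "norm x \<le> \<rho>" for x y :: 'a
    using that norm_triangle_ineq2[of y x] by (simp add: dist_norm norm_minus_commute)
  have up: "closed_segment x (?L x) \<subseteq> ?S" if x: "x \<in> ?S" for x
  proof
    fix v assume v: "v \<in> closed_segment x (?L x)"
    have x_le: "norm x \<le> \<rho>"
      using x by simp
    have "v \<in> cball 0 \<rho>"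
      using v x_le norm_lift_to_sphere[OF e x_le]
        closed_segment_subset[OF _ _ convex_cball, of x 0 \<rho> "?L x"] by auto
    moreover have "r < dist v y" if y: "y \<in> Y" for y
    proof (cases "r + \<rho> < norm y")
      case True
      then show ?thesis
        using far \<open>v \<in> cball 0 \<rho>\<close> by simp
    next
      case False
      then have "y \<bullet> e < - \<rho>"
        using below[OF y] by blast
      moreover have "- \<rho> \<le> x \<bullet> e"
        using Cauchy_Schwarz_ineq2[of x e] e x_le by simp
      ultimately have "y \<bullet> e \<le> x \<bullet> e"
        by simp
      moreover obtain u where "0 \<le> u" "v = x + (u * height_below_sphere \<rho> e x) *\<^sub>R e"
        using v by (auto simp: closed_segment_def lift_to_sphere_def algebra_simps)
      ultimately have "dist x y \<le> dist v y"
        using height_below_sphere_nonneg[OF x_le] by (simp add: dist_mono_moving_away)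
      then show ?thesis
        using x y by force
    qed
    ultimately show "v \<in> ?S"
      by simp
  qed
  have to_sphere: "path_component ?S x (?L x)" if "x \<in> ?S" for x
    using up[OF that] by (meson convex_closed_segment convex_imp_path_connected
        ends_in_segment path_component_of_subset path_connected_component)
  have "path_component ?S x x'" if x: "x \<in> ?S" and x': "x' \<in> ?S" for x x'
  proof -
    have le: "norm x \<le> \<rho>" "norm x' \<le> \<rho>"
      using x x' by auto
    have z: "?L x \<in> ?S" "?L x' \<in> ?S"
      using up[OF x] up[OF x'] by auto
    let ?arc = "?L ` closed_segment (?L x) (?L x')"
    have "?L (?L x) = ?L x" "?L (?L x') = ?L x'"
      using e le by (simp_all add: lift_to_sphere_fixes_upper_hemisphere norm_lift_to_sphere
          inner_lift_to_sphere_nonneg)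
    then have ends: "?L x \<in> ?arc" "?L x' \<in> ?arc"
      by (metis ends_in_segment(1) imageI, metis ends_in_segment(2) imageI)
    have "path_connected ?arc"
      by (intro path_connected_continuous_image continuous_on_lift_to_sphere
          convex_imp_path_connected convex_closed_segment)
    moreover have "?arc \<subseteq> ?S"
    proof
      fix v assume "v \<in> ?arc"
      then obtain p where p: "p \<in> closed_segment (?L x) (?L x')" and v: "v = ?L p"
        by blast
      have "norm p \<le> \<rho>"
        using p z closed_segment_subset[OF _ _ convex_cball, of "?L x" 0 \<rho> "?L x'"] by auto
      then have v_norm: "norm v = \<rho>"
        using v norm_lift_to_sphere[OF e] by simp
      moreover have "r < dist v y" if y: "y \<in> Y" for y
      proof (cases "r + \<rho> < norm y")
        case True
        then show ?thesis
          using far v_norm by simp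
      next
        case False
        moreover have "0 \<le> \<rho>"
          using v_norm by auto
        ultimately have "y \<bullet> e \<le> 0"
          using below[OF y] by auto
        then show ?thesis
          unfolding v using z y
          by (intro dist_lift_of_chord[OF e _ r norm_lift_to_sphere[OF e le(1)] _
                norm_lift_to_sphere[OF e le(2)] _ p]) simp_all
      qed
      ultimately show "v \<in> ?S"
        by simp
    qed
    ultimately have "path_component ?S (?L x) (?L x')"
      using ends by (meson path_component_of_subset path_connected_component)
    then show ?thesis
      using to_sphere[OF x] to_sphere[OF x'] path_component_sym path_component_trans by blast
  qed
  then show ?thesis
    by (simp add: path_connected_component)
qed

theorem lemma3p2:
  fixes M :: "'w measure"
    and W :: "nat \<Rightarrow> real \<Rightarrow> 'w \<Rightarrow> real ^ 'd"
    and \<epsilon> :: real and K :: nat and \<omega> :: 'w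
  assumes "CARD('d) \<ge> 3"
    and "0 < \<epsilon>" and "\<epsilon> < 1"
    and "K \<ge> 1"
    and "\<And>k. k \<in> {1..K} \<Longrightarrow> brownian_motion M (W k)"
    and "\<omega> \<in> space M"
    and "\<exists>C\<^sub>1 C\<^sub>2. C\<^sub>1 \<in> components (vacant_set K (\<lambda>k t. W k t \<omega>) \<inter> cball 0 \<epsilon>) \<and>
                C\<^sub>2 \<in> components (vacant_set K (\<lambda>k t. W k t \<omega>) \<inter> cball 0 \<epsilon>) \<and>
                C\<^sub>1 \<noteq> C\<^sub>2"
  shows "(\<forall>e :: real ^ 'd. norm e = 1 \<longrightarrow>
            (\<exists>k\<in>{1..K}. hits (\<lambda>t. W k t \<omega>) {x \<in> cball 0 (1 + \<epsilon>). x \<bullet> e \<ge> - \<epsilon>})) \<and>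
         (\<forall>k\<in>{1..K}. \<not> hits (\<lambda>t. W k t \<omega>) (cball 0 (1 - \<epsilon>)))"
proof -
  let ?w = "\<lambda>k t. W k t \<omega>"
  let ?S = "vacant_set K ?w \<inter> cball 0 \<epsilon>"
  obtain C\<^sub>1 C\<^sub>2 where C: "C\<^sub>1 \<in> components ?S" "C\<^sub>2 \<in> components ?S" "C\<^sub>1 \<noteq> C\<^sub>2"
    using assms(7) by blast
  have sub: "C\<^sub>1 \<subseteq> ?S" "C\<^sub>2 \<subseteq> ?S"
    using C by (simp_all only: in_components_subset)
  have ne: "C\<^sub>1 \<noteq> {}" "C\<^sub>2 \<noteq> {}"
    using C in_components_nonempty by blast+
  have "\<not> connected ?S"
    using C sub ne joinable_components_eq[of ?S ?S C\<^sub>1 C\<^sub>2] by blast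
  have "\<exists>k\<in>{1..K}. hits (?w k) {x \<in> cball 0 (1 + \<epsilon>). x \<bullet> e \<ge> - \<epsilon>}" if e: "norm e = 1" for e
  proof (rule ccontr)
    assume "\<not> ?thesis"
    then have miss: "\<not> (norm (?w k t) \<le> 1 + \<epsilon> \<and> ?w k t \<bullet> e \<ge> - \<epsilon>)" if "k \<in> {1..K}" "0 \<le> t" for k t
      using that by (auto simp: hits_def)
    define Y where "Y = {?w k t | k t. k \<in> {1..K} \<and> 0 \<le> t}"
    have "1 + \<epsilon> < norm y \<or> y \<bullet> e < - \<epsilon>" if "y \<in> Y" for y
      using that miss by (force simp: Y_def not_le)
    then have "path_connected {x \<in> cball 0 \<epsilon>. \<forall>y\<in>Y. 1 < dist x y}"
      using e by (intro path_connected_outside_balls_below[of e]) auto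
    moreover have "{x \<in> cball 0 \<epsilon>. \<forall>y\<in>Y. 1 < dist x y} = ?S"
    proof -
      have "vacant_set K ?w = {x. \<forall>y\<in>Y. 1 < dist x y}"
        unfolding vacant_set_def Y_def by (force simp: dist_commute)
      then show ?thesis
        by blast
    qed
    ultimately show False
      using \<open>\<not> connected ?S\<close> path_connected_imp_connected by metis
  qed
  moreover have "\<not> hits (?w k) (cball 0 (1 - \<epsilon>))" if k: "k \<in> {1..K}" for k
  proof
    assume "hits (?w k) (cball 0 (1 - \<epsilon>))"
    then obtain t where t: "0 \<le> t" "norm (?w k t) \<le> 1 - \<epsilon>"
      by (auto simp: hits_def)
    have "x \<in> cball (?w k t) 1" if "x \<in> cball 0 \<epsilon>" for x
      using that t norm_triangle_ineq4[of "?w k t" x] by (simp add: dist_norm)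
    then have "?S = {}"
      using k t(1) by (fastforce simp: vacant_set_def)
    then show False
      using sub ne by simp
  qed
  ultimately show ?thesis
    by blast
qed

end
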